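(* Consider a radial connected network (tree) rooted at bus $0$ with buses $\{0,1,\dots,N\}$, lines $\mathcal{L}=\{1,\dots,L\}$ ($L=N$), known resistance-to-reactance ratios $z_1,\dots,z_L$, and measurements $\boldsymbol{p}[k'],\boldsymbol{q}[k'],\tilde{\boldsymbol{v}}[k']\in\mathbb{R}^N$ for $k'\in\mathcal{K}=\{k-m,\dots,k\}$, with the matrix $\boldsymbol{\Psi}[k]$, the vector $\boldsymbol{\psi}[k]$ and the notion of identifiability as defined in the context. For every line $\ell\in\mathcal{L}$, the parameter $x_\ell$ of line $\ell$ is identifiable from the measurements in $\mathcal{K}$ if and only if there exists some $k'\in\mathcal{K}$ such that $$\sum_{i\in\mathcal{N}_\ell}\bigl(z_\ell\, p_i[k']+q_i[k']\bigr)\neq 0,$$ where $\mathcal{N}_\ell$ is the set of downstream buses of line $\ell$.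
   Context: Network. The power distribution system is a directed graph on buses $\{0,1,\dots,N\}$ with lines indexed by $\mathcal{L}=\{1,\dots,L\}$. It is radial and connected, i.e. the underlying undirected graph is a tree, so $L=N$. Bus $0$ is the root. Each line is directed from its sending end to its receiving end, and the sending end is the endpoint closer to the root. For $i\in\{1,\dots,N\}$, let $\mathcal{P}_i\subseteq\mathcal{L}$ be the set of lines forming the unique path from bus $0$ to bus $i$. Bus $i$ is a downstream bus of line $\ell$ if $\ell\in\mathcal{P}_i$, and $\mathcal{N}_\ell=\{i\in\{1,\dots,N\}:\ell\in\mathcal{P}_i\}$ is the set of downstream buses of $\ell$. Incidence matrix. The node-to-edge incidence matrix is the $(N+1)\times L$ matrix with entry $1$ at $(i,\ell)$ and $-1$ at $(j,\ell)$ if line $\ell$ starts at bus $i$ and ends at bus $j$, and all other entries zero. $\boldsymbol{M}\in\mathbb{R}^{N\times L}$ is obtained by deleting the row of bus $0$; it is invertible. The topology, i.e. $\boldsymbol{M}$, is given. Line parameters. Line $\ell$ has resistance $r_\ell$ and reactance $x_\ell$ with $r_\ell=z_\ell x_\ell$, where the ratios $z_\ell\in\mathbb{R}$ are known. Thus the unknown parameter of line $\ell$ is $x_\ell$ (and $r_\ell$ is recovered as $z_\ell x_\ell$). Write $\boldsymbol{x}=[x_1,\dots,x_L]^\top\in\mathbb{R}^L$. Measurements. For integers $k$ and $m\ge 0$, let $\mathcal{K}=\{k-m,\dots,k\}$. For each $k'\in\mathcal{K}$ there are measured vectors $\boldsymbol{p}[k']=[p_i[k']]^\top$ and $\boldsymbol{q}[k']=[q_i[k']]^\top$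 in $\mathbb{R}^N$ (net active and reactive power injections at buses $1,\dots,N$), and $\tilde{\boldsymbol{v}}[k']\in\mathbb{R}^N$ (squared voltage magnitudes at buses $1,\dots,N$ minus the squared voltage magnitude at bus $0$). The model relating them is $\tilde{\boldsymbol{v}}=\boldsymbol{R}\boldsymbol{p}+\boldsymbol{X}\boldsymbol{q}$ with $\boldsymbol{R}=2(\boldsymbol{M}^{-1})^\top\mathrm{diag}(r_1,\dots,r_L)\boldsymbol{M}^{-1}$ and $\boldsymbol{X}=2(\boldsymbol{M}^{-1})^\top\mathrm{diag}(x_1,\dots,x_L)\boldsymbol{M}^{-1}$. Estimation problem. Fix a discount factor $\gamma\in(0,1]$. Let $\boldsymbol{e}_\ell$ be the $\ell$-th standard basis vector of $\mathbb{R}^L$, and set $$\boldsymbol{\Xi}_\ell=2(\boldsymbol{M}^{-1})^\top\boldsymbol{e}_\ell\boldsymbol{e}_\ell^\top\boldsymbol{M}^{-1},\qquad \boldsymbol{\rho}_\ell[k']=\gamma^{(k-k')/2}\bigl(z_\ell\boldsymbol{p}[k']+\boldsymbol{q}[k']\bigr).$$ $\boldsymbol{\Psi}[k]\in\mathbb{R}^{(m+1)N\times L}$ is the matrix whose $\ell$-th column is obtained by stacking vertically the vectors $\boldsymbol{\Xi}_\ell\boldsymbol{\rho}_\ell[k-m],\dots,\boldsymbol{\Xi}_\ell\boldsymbol{\rho}_\ell[k]$, and $\boldsymbol{\psi}[k]\in\mathbb{R}^{(m+1)N}$ is obtained by stacking $\gamma^{(k-k')/2}\tilde{\boldsymbol{v}}[k']$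 for $k'=k-m,\dots,k$. The line parameters are estimated by the least-squares problem $$\min_{\boldsymbol{x}\in\mathbb{R}^L}\ \|\boldsymbol{\Psi}[k]\boldsymbol{x}-\boldsymbol{\psi}[k]\|^2$$ with the Euclidean norm. Identifiability. The parameter $x_\ell$ is identifiable (from the measurements in $\mathcal{K}$) if it is uniquely determined by this least-squares problem, i.e. all minimizers $\boldsymbol{x}$ have the same $\ell$-th coordinate. *)

theory Defs
  imports Complex_Main "Graph_Theory.Graph_Theory"
    "Jordan_Normal_Form.Gauss_Jordan_Elimination"
begin

section \<open>Radial networks\<close>

text \<open>
  The underlying undirected multigraph: every line \<open>l\<close> may be traversed along its
  direction, as \<open>(l, True)\<close>, or against it, as \<open>(l, False)\<close>.
\<close>

definition undirected :: "('a, 'b) pre_digraph \<Rightarrow> ('a, 'b \<times> bool) pre_digraph" where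
  "undirected G = \<lparr>verts = verts G, arcs = arcs G \<times> UNIV,
     tail = (\<lambda>(l, fwd). if fwd then tail G l else head G l),
     head = (\<lambda>(l, fwd). if fwd then head G l else tail G l)\<rparr>"

text \<open>
  The library predicate \<open>tree\<close> only excludes directed cycles, so it does not express that
  the underlying undirected graph is a tree. An undirected cycle uses every line at most
  once; this rules out going back and forth along one line, but a pair of parallel or
  antiparallel lines is a cycle.
\<close>

definition undirected_cycle :: "('a, 'b) pre_digraph \<Rightarrow> ('b \<times> bool) list \<Rightarrow> bool" where
  "undirected_cycle G c \<longleftrightarrow>
     pre_digraph.cycle (undirected G) c \<and> distinct (map fst c)"

definition undirected_tree :: "('a, 'b) pre_digraph \<Rightarrow> bool" where
  "undirected_tree G \<longleftrightarrow>
     strongly_connected (undirected G) \<and> \<not> (\<exists>c. undirected_cycle G c)"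

definition root_path :: "(nat, 'b) pre_digraph \<Rightarrow> nat \<Rightarrow> ('b \<times> bool) list" where
  "root_path G i = (THE c. pre_digraph.apath (undirected G) 0 c i)"

definition path_lines :: "(nat, 'b) pre_digraph \<Rightarrow> nat \<Rightarrow> 'b set" where
  "path_lines G i = fst ` set (root_path G i)"

text \<open>Buses are \<open>0, \<dots>, N\<close> with root \<open>0\<close>, lines are \<open>1, \<dots>, L\<close>; \<open>L = N\<close> is a consequence.\<close>

definition radial_network :: "nat \<Rightarrow> nat \<Rightarrow> (nat, nat) pre_digraph \<Rightarrow> bool" where
  "radial_network N L G \<longleftrightarrow>
     wf_digraph G \<and> verts G = {0..N} \<and> arcs G = {1..L} \<and> undirected_tree G \<and>
     (\<forall>l \<in> arcs G. length (root_path G (tail G l)) < length (root_path G (head G l)))"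

definition downstream :: "nat \<Rightarrow> (nat, nat) pre_digraph \<Rightarrow> nat \<Rightarrow> nat set" where
  "downstream N G l = {i \<in> {1..N}. l \<in> path_lines G i}"


section \<open>The least-squares problem\<close>

text \<open>
  Matrices and vectors are indexed from \<open>0\<close>. Hence line \<open>l\<close> has position \<open>l - 1\<close> in vectors
  over the lines, and bus \<open>i \<ge> 1\<close> has position \<open>i - 1\<close> in vectors over the non-root buses.
\<close>

definition incidence_mat :: "nat \<Rightarrow> nat \<Rightarrow> (nat, nat) pre_digraph \<Rightarrow> real mat" where
  "incidence_mat N L G = mat (N + 1) L (\<lambda>(i, j).
     if tail G (Suc j) = i then 1 else if head G (Suc j) = i then -1 else 0)"

definition reduced_incidence_mat :: "nat \<Rightarrow> nat \<Rightarrow> (nat, nat) pre_digraph \<Rightarrow> real mat" where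
  "reduced_incidence_mat N L G = mat N L (\<lambda>(i, j). incidence_mat N L G $$ (Suc i, j))"

definition bus_vec :: "nat \<Rightarrow> (nat \<Rightarrow> real) \<Rightarrow> real vec" where
  "bus_vec N f = vec N (\<lambda>i. f (Suc i))"

definition Xi :: "nat \<Rightarrow> nat \<Rightarrow> (nat, nat) pre_digraph \<Rightarrow> nat \<Rightarrow> real mat" where
  "Xi N L G l =
     (let Minv = the (mat_inverse (reduced_incidence_mat N L G));
          e = mat_of_cols L [unit_vec L (l - 1)]
      in 2 \<cdot>\<^sub>m (transpose_mat Minv * e * transpose_mat e * Minv))"

definition discount :: "real \<Rightarrow> int \<Rightarrow> int \<Rightarrow> real" where
  "discount \<gamma> k k' = \<gamma> powr (real_of_int (k - k') / 2)"

definition rho :: "nat \<Rightarrow> real \<Rightarrow> int \<Rightarrow> (nat \<Rightarrow> real) \<Rightarrow> (int \<Rightarrow> nat \<Rightarrow> real) \<Rightarrow>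
    (int \<Rightarrow> nat \<Rightarrow> real) \<Rightarrow> nat \<Rightarrow> int \<Rightarrow> real vec" where
  "rho N \<gamma> k z p q l k' =
     discount \<gamma> k k' \<cdot>\<^sub>v (z l \<cdot>\<^sub>v bus_vec N (p k') + bus_vec N (q k'))"

text \<open>Stacks the vectors \<open>f (k - m), \<dots>, f k\<close>, each of dimension \<open>N\<close>.\<close>

definition stack :: "nat \<Rightarrow> int \<Rightarrow> nat \<Rightarrow> (int \<Rightarrow> real vec) \<Rightarrow> real vec" where
  "stack N k m f = vec ((m + 1) * N) (\<lambda>r. f (k - int m + int (r div N)) $ (r mod N))"

definition Psi :: "nat \<Rightarrow> nat \<Rightarrow> (nat, nat) pre_digraph \<Rightarrow> real \<Rightarrow> int \<Rightarrow> nat \<Rightarrow>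
    (nat \<Rightarrow> real) \<Rightarrow> (int \<Rightarrow> nat \<Rightarrow> real) \<Rightarrow> (int \<Rightarrow> nat \<Rightarrow> real) \<Rightarrow> real mat" where
  "Psi N L G \<gamma> k m z p q = mat_of_cols ((m + 1) * N)
     (map (\<lambda>l. stack N k m (\<lambda>k'. Xi N L G l *\<^sub>v rho N \<gamma> k z p q l k')) [1..<L + 1])"

definition psi :: "nat \<Rightarrow> real \<Rightarrow> int \<Rightarrow> nat \<Rightarrow> (int \<Rightarrow> nat \<Rightarrow> real) \<Rightarrow> real vec" where
  "psi N \<gamma> k m v = stack N k m (\<lambda>k'. discount \<gamma> k k' \<cdot>\<^sub>v bus_vec N (v k'))"

definition euclidean_norm :: "real vec \<Rightarrow> real" where
  "euclidean_norm u = sqrt (u \<bullet> u)"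

definition least_squares_minimizer :: "nat \<Rightarrow> real mat \<Rightarrow> real vec \<Rightarrow> real vec \<Rightarrow> bool" where
  "least_squares_minimizer L A b =
     is_arg_min (\<lambda>x. (euclidean_norm (A *\<^sub>v x - b))\<^sup>2) (\<lambda>x. x \<in> carrier_vec L)"

text \<open>
  \<open>p k' i\<close>, \<open>q k' i\<close> and \<open>v k' i\<close> are the injections and the shifted squared voltage
  magnitude at bus \<open>i\<close> and time \<open>k'\<close>; only \<open>i \<in> {1..N}\<close> and \<open>k' \<in> {k - m..k}\<close> matter.
\<close>

definition identifiable :: "nat \<Rightarrow> nat \<Rightarrow> (nat, nat) pre_digraph \<Rightarrow> real \<Rightarrow> int \<Rightarrow> nat \<Rightarrow>
    (nat \<Rightarrow> real) \<Rightarrow> (int \<Rightarrow> nat \<Rightarrow> real) \<Rightarrow> (int \<Rightarrow> nat \<Rightarrow> real) \<Rightarrow> (int \<Rightarrow> nat \<Rightarrow> real) \<Rightarrow>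
    nat \<Rightarrow> bool" where
  "identifiable N L G \<gamma> k m z p q v l \<longleftrightarrow>
     (\<forall>x y. least_squares_minimizer L (Psi N L G \<gamma> k m z p q) (psi N \<gamma> k m v) x \<longrightarrow>
            least_squares_minimizer L (Psi N L G \<gamma> k m z p q) (psi N \<gamma> k m v) y \<longrightarrow>
            x $ (l - 1) = y $ (l - 1))"

end

theory Submission
  imports Defs "Jordan_Normal_Form.Determinant"
begin

text \<open>
  Write \<open>M\<close> for the reduced incidence matrix, \<open>b\<^sub>l\<close> for row \<open>l\<close> of its inverse, and
  \<open>s\<^sub>l(k')\<close> for the sum of \<open>z\<^sub>l p\<^sub>i[k'] + q\<^sub>i[k']\<close> over the downstream buses \<open>i\<close> of line \<open>l\<close>.

  In a tree with all lines directed away from the root, the root path of the receiving end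
  of a line \<open>l\<close> is the root path of its sending end followed by \<open>l\<close> (\<open>root_path_head\<close>).
  Hence the receiving ends number the non-root buses by the lines, so \<open>M\<close> is square, and the
  inverse of \<open>M\<close> has the entry \<open>-1\<close> at \<open>(l, i)\<close> if \<open>l\<close> lies on the root path of \<open>i\<close>,
  and \<open>0\<close> otherwise (\<open>path_mat_mult_incidence\<close>). In other words, \<open>b\<^sub>l\<close> is minus the
  indicator of the buses downstream of \<open>l\<close>.

  As \<open>\<Xi>\<^sub>l = 2 b\<^sub>l b\<^sub>l\<^sup>T\<close> has rank one, the block of \<open>\<Psi> u\<close> at time \<open>k'\<close> is, up to a nonzero
  discount factor, \<open>-2\<close> times the combination of the \<open>b\<^sub>l\<close> with coefficients
  \<open>s\<^sub>l(k') u\<^sub>l\<close> (\<open>Psi_mult_vec\<close>). The \<open>b\<^sub>l\<close> are linearly independent, so \<open>u\<close> is in the kernel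
  of \<open>\<Psi>\<close> iff \<open>s\<^sub>l(k') u\<^sub>l = 0\<close> for all \<open>l\<close> and \<open>k'\<close> (\<open>Psi_kernel_iff\<close>).

  A least-squares problem always has a minimizer, and its minimizers form a translate of the
  kernel. A coordinate is therefore uniquely determined iff it vanishes on the kernel
  (\<open>least_squares_coordinate_unique_iff\<close>). By the description of the kernel, coordinate
  \<open>l\<close> vanishes on it iff some \<open>s\<^sub>l(k')\<close> is nonzero: otherwise the unit vector of \<open>l\<close> is in the
  kernel.
\<close>

section \<open>Unique paths in undirected trees\<close>

definition flip :: "'b \<times> bool \<Rightarrow> 'b \<times> bool" where
  "flip a = (fst a, \<not> snd a)"

lemma flip_flip [simp]: "flip (flip a) = a"
  by (simp add: flip_def)

lemma fst_flip [simp]: "fst (flip a) = fst a"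
  by (simp add: flip_def)

lemma flip_eq_iff [simp]: "flip a = flip b \<longleftrightarrow> a = b"
  by (auto simp: flip_def prod_eq_iff)

text \<open>
  Uniqueness of paths cannot be argued through arbitrary closed walks, since going back and
  forth along one line is a closed walk in every tree. Walks that never turn around on a line
  are the right class: it contains all paths, is closed under taking infixes, and two
  distinct walks with the same ends yield a nonempty closed one.
\<close>

abbreviation non_backtracking :: "('b \<times> bool) list \<Rightarrow> bool" where
  "non_backtracking \<equiv> successively (\<lambda>a b. b \<noteq> flip a)"

lemma undirected_simps [simp]:
  "verts (undirected G) = verts G"
  "a \<in> arcs (undirected G) \<longleftrightarrow> fst a \<in> arcs G"
  "tail (undirected G) (l, fwd) = (if fwd then tail G l else head G l)"
  "head (undirected G) (l, fwd) = (if fwd then head G l else tail G l)"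
  "tail (undirected G) (flip a) = head (undirected G) a"
  "head (undirected G) (flip a) = tail (undirected G) a"
  by (auto simp: undirected_def flip_def mem_Times_iff split: prod.splits)

lemma wf_digraph_undirected: "wf_digraph G \<Longrightarrow> wf_digraph (undirected G)"
  by (auto simp: wf_digraph_def)

context
  fixes G :: "('a, 'b) pre_digraph"
  assumes wf: "wf_digraph G"
begin

interpretation U: wf_digraph "undirected G"
  using wf by (rule wf_digraph_undirected)

text \<open>
  Turning around on a line means returning to the vertex visited two steps before.
\<close>

lemma apath_non_backtracking: "U.apath u p v \<Longrightarrow> non_backtracking p"
proof (induction p arbitrary: u)
  case (Cons a p)
  then have p: "U.apath (head (undirected G) a) p v"
    and new: "tail (undirected G) a \<notin> set (U.awalk_verts (head (undirected G) a) p)"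
    by (auto simp: U.apath_Cons_iff)
  have "hd p \<noteq> flip a" if "p \<noteq> []"
  proof
    assume "hd p = flip a"
    then obtain p' where p': "p = flip a # p'" using \<open>p \<noteq> []\<close> by (cases p) auto
    then have "U.awalk (tail (undirected G) a) p' v"
      using p by (simp add: U.apath_def U.awalk_Cons_iff)
    then show False using new p' U.hd_in_awalk_verts(1) by auto
  qed
  then show ?case using Cons.IH[OF p] by (auto simp: successively_Cons)
qed simp

lemma awalk_reverse: "U.awalk u p v \<Longrightarrow> U.awalk v (rev (map flip p)) u"
proof (induction p arbitrary: u)
  case (Cons a p)
  then have "U.awalk v (rev (map flip p)) (head (undirected G) a)"
    by (simp add: U.awalk_Cons_iff)
  moreover have "U.awalk (head (undirected G) a) [flip a] u"
    using Cons.prems U.head_in_verts[of a] U.tail_in_verts[of a]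
    by (auto simp: U.awalk_Cons_iff U.awalk_Nil_iff)
  ultimately show ?case
    by (simp only: list.map rev.simps) (rule U.awalk_appendI)
qed (simp add: U.awalk_Nil_iff)

text \<open>
  A line traversed twice in the same direction would be a repeated arc. Traversed in opposite
  directions, it would make the walk re-enter the vertex reached by the first traversal just
  before the second one. As that vertex is visited only once, the second traversal would
  directly follow the first, which is backtracking.
\<close>

lemma simple_closed_walk_is_undirected_cycle:
  assumes p: "U.awalk u p u" "p \<noteq> []" and simple: "distinct (tl (U.awalk_verts u p))"
    and nb: "non_backtracking p"
  shows "undirected_cycle G p"
proof -
  have "distinct (map fst p)"
  proof (rule ccontr)
    assume "\<not> distinct (map fst p)"
    then obtain ks l ls ms where "map fst p = ks @ [l] @ ls @ [l] @ ms"
      using not_distinct_decomp by blast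
    then obtain xs a ys b zs where decomp: "p = xs @ a # ys @ b # zs" and ab: "fst a = fst b"
      by (force simp: map_eq_append_conv map_eq_Cons_conv append_eq_map_conv)
    have "distinct p"
      using U.distinct_tl_verts_imp_distinct[OF p(1) simple] .
    then have flip: "b = flip a"
      using ab by (auto simp: decomp flip_def prod_eq_iff)
    have "U.cas u p u" using p(1) by (simp add: U.awalk_def)
    then have heads: "distinct (map (head (undirected G)) p)"
      using simple p(2) by (simp add: U.awalk_verts_conv')
    (* Nothing between the two traversals is backtracking; otherwise the arc before the
       second traversal has the same head as the first one. *)
    show False
    proof (cases ys rule: rev_cases)
      case Nil
      then show False
        using nb flip by (simp add: decomp successively_append_iff)
    next
      case (snoc ys' c)
      have "head (undirected G) c = tail (undirected G) b"
        using \<open>U.cas u p u\<close> by (simp add: decomp snoc)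
      then show False
        using heads flip by (simp add: decomp snoc)
    qed
  qed
  then show ?thesis
    using p simple by (auto simp: undirected_cycle_def U.cycle_def)
qed

text \<open>
  A shortest closed infix of the walk repeats no vertex, and it inherits the absence of
  backtracking.
\<close>

lemma closed_non_backtracking_walk_imp_cycle:
  assumes "U.awalk u p u" "p \<noteq> []" "non_backtracking p"
  shows "\<exists>c. undirected_cycle G c"
  using assms
proof (induction "length p" arbitrary: u p rule: less_induct)
  case less
  show ?case
  proof (cases "distinct (tl (U.awalk_verts u p))")
    case True
    then show ?thesis
      using simple_closed_walk_is_undirected_cycle less.prems by blast
  next
    case False
    obtain a p' where p: "p = a # p'" using less.prems(2) by (cases p) auto
    with less.prems(1) False have p':
      "U.awalk (head (undirected G) a) p' u"
      "\<not> distinct (U.awalk_verts (head (undirected G) a) p')"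
      by (auto simp: U.awalk_Cons_iff)
    obtain q r s w where "p' = q @ r @ s" "r \<noteq> []" "U.awalk w r w"
      using U.awalk_not_distinct_decomp[OF p'] by auto
    moreover from this have "non_backtracking r"
      using less.prems(3) by (auto simp: p successively_Cons successively_append_iff)
    ultimately show ?thesis
      using less.hyps[of r w] by (simp add: p)
  qed
qed

text \<open>
  After removal of a common suffix, one walk followed by the reverse of the other does not turn
  around where they are joined, because their last arcs differ. So it is a closed
  non-backtracking walk and would contain a cycle.
\<close>

lemma non_backtracking_walk_unique:
  assumes acyclic: "\<nexists>c. undirected_cycle G c"
    and "U.awalk u c v" "non_backtracking c" and "U.awalk u d v" "non_backtracking d"
  shows "c = d"
  using assms(2-)
proof (induction c arbitrary: d v rule: rev_induct)
  case Nil
  then have "u = v" by (simp add: U.awalk_Nil_iff)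
  then show ?case
    using Nil closed_non_backtracking_walk_imp_cycle[of u d] acyclic by auto
next
  case (snoc a c)
  show ?case
  proof (cases d rule: rev_cases)
    case Nil
    with snoc.prems have "u = v" by (simp add: U.awalk_Nil_iff del: U.awalk_append_iff)
    then show ?thesis
      using snoc.prems closed_non_backtracking_walk_imp_cycle[of u "c @ [a]"] acyclic by auto
  next
    case d: (snoc d' b)
    show ?thesis
    (* Equal last arcs are a common suffix and are stripped; different ones give a closed walk. *)
    proof (cases "a = b")
      case True
      have "U.awalk u c (tail (undirected G) a)" "U.awalk u d' (tail (undirected G) b)"
        using snoc.prems by (auto simp: d U.awalk_Cons_iff)
      then show ?thesis
        using snoc.IH[of "tail (undirected G) a" d'] snoc.prems True
        by (auto simp: d successively_append_iff)
    next
      case False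
      have "U.awalk u ((c @ [a]) @ rev (map flip d)) u"
        using snoc.prems by (blast intro: U.awalk_appendI awalk_reverse)
      moreover have "non_backtracking (rev (map flip d))"
        using snoc.prems(4) unfolding successively_rev successively_map
        by (rule successively_mono) auto
      then have "non_backtracking ((c @ [a]) @ rev (map flip d))"
        using snoc.prems(2) False by (auto simp: d successively_append_iff)
      ultimately show ?thesis
        using closed_non_backtracking_walk_imp_cycle acyclic by blast
    qed
  qed
qed

lemma undirected_tree_ex1_apath:
  assumes tree: "undirected_tree G" and uv: "u \<in> verts G" "v \<in> verts G"
  shows "\<exists>!c. U.apath u c v"
proof -
  have "u \<rightarrow>\<^sup>*\<^bsub>undirected G\<^esub> v"
    using tree uv by (auto simp: undirected_tree_def strongly_connected_def)
  then obtain c where c: "U.apath u c v" by (auto simp: U.reachable_apath)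
  have "d = c" if d: "U.apath u d v" for d
  proof (rule non_backtracking_walk_unique)
    show "\<nexists>c. undirected_cycle G c" using tree by (simp add: undirected_tree_def)
  qed (use c d apath_non_backtracking in \<open>auto simp: U.apath_def\<close>)
  with c show ?thesis by blast
qed

end


section \<open>Root paths in a radial network\<close>

locale radial =
  fixes N L :: nat and G :: "(nat, nat) pre_digraph"
  assumes radial: "radial_network N L G"
begin

lemma wf: "wf_digraph G" and verts: "verts G = {0..N}" and arcs: "arcs G = {1..L}"
  and tree: "undirected_tree G"
  and away: "l \<in> {1..L} \<Longrightarrow> length (root_path G (tail G l)) < length (root_path G (head G l))"
  using radial by (auto simp: radial_network_def)

sublocale U: wf_digraph "undirected G"
  using wf by (rule wf_digraph_undirected)

lemma ends_in_buses:
  assumes "l \<in> {1..L}"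
  shows "tail G l \<in> {0..N}" "head G l \<in> {0..N}"
  using wf assms by (auto simp: wf_digraph_def verts arcs)

lemma apath_root_path: "i \<le> N \<Longrightarrow> U.apath 0 (root_path G i) i"
  unfolding root_path_def
  by (rule theI', rule undirected_tree_ex1_apath[OF wf tree]) (auto simp: verts)

lemma root_path_eqI:
  assumes c: "U.apath 0 c i"
  shows "root_path G i = c"
  unfolding root_path_def
proof (rule the1_equality[OF undirected_tree_ex1_apath[OF wf tree] c])
  show "0 \<in> verts G" "i \<in> verts G"
    using c by (auto simp: U.apath_def verts)
qed

lemma root_path_root [simp]: "root_path G 0 = []"
  by (rule root_path_eqI) (simp add: U.apath_Nil_iff verts)

text \<open>
  Otherwise a prefix of the root path of the sending end would be the root path of the receiving
  end, but the latter is longer since lines point away from the root.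
\<close>

lemma head_not_on_root_path_tail:
  assumes l: "l \<in> {1..L}"
  shows "head G l \<notin> set (U.awalk_verts 0 (root_path G (tail G l)))"
proof
  let ?p = "root_path G (tail G l)"
  assume head: "head G l \<in> set (U.awalk_verts 0 ?p)"
  have p: "U.apath 0 ?p (tail G l)"
    using apath_root_path ends_in_buses(1)[OF l] by simp
  then obtain q r where qr: "?p = q @ r" "U.awalk 0 q (head G l)"
    using U.awalk_decomp[of 0 ?p "tail G l", OF _ head] unfolding U.apath_def by blast
  have "U.apath 0 q (U.awlast 0 q)"
    using p unfolding qr(1) U.apath_append_iff by blast
  then have "root_path G (head G l) = q"
    using qr(2) by (intro root_path_eqI) auto
  then show False using away[OF l] qr(1) by simp
qed

text \<open>
  The recursive description of root paths: appending the line keeps the walk a path, and paths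
  are unique.
\<close>

lemma root_path_head:
  assumes l: "l \<in> {1..L}"
  shows "root_path G (head G l) = root_path G (tail G l) @ [(l, True)]"
proof (rule root_path_eqI)
  let ?p = "root_path G (tail G l)"
  have p: "U.apath 0 ?p (tail G l)"
    using apath_root_path ends_in_buses(1)[OF l] by simp
  then have "U.awlast 0 ?p = tail G l" by (auto simp: U.apath_def)
  moreover have "tail G l \<noteq> head G l" using away[OF l] by auto
  moreover have "head G l \<in> verts G" using ends_in_buses(2)[OF l] by (simp add: verts)
  ultimately show "U.apath 0 (?p @ [(l, True)]) (head G l)"
    using p l head_not_on_root_path_tail[OF l]
    by (simp add: U.apath_append_iff U.apath_Cons_iff U.apath_Nil_iff arcs)
qed

lemma line_not_on_root_path_tail:
  assumes l: "l \<in> {1..L}"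
  shows "l \<notin> path_lines G (tail G l)"
proof
  let ?p = "root_path G (tail G l)"
  assume "l \<in> path_lines G (tail G l)"
  then obtain fwd where "(l, fwd) \<in> set ?p" by (auto simp: path_lines_def)
  moreover have "U.cas 0 ?p (tail G l)"
    using apath_root_path ends_in_buses(1)[OF l] by (auto simp: U.apath_def)
  ultimately have "head G l \<in> set (U.awalk_verts 0 ?p)"
    by (cases fwd) (force simp: U.set_awalk_verts_cas)+
  then show False using head_not_on_root_path_tail[OF l] by simp
qed

lemma path_lines_head:
  "l \<in> {1..L} \<Longrightarrow> path_lines G (head G l) = insert l (path_lines G (tail G l))"
  unfolding path_lines_def by (simp only: root_path_head) simp

text \<open>
  The inverse sends a bus to the last line of its root path. That line is traversed forwards: if
  it were traversed backwards, its sending end would have the longer root path.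
\<close>

lemma bij_betw_head: "bij_betw (head G) {1..L} {1..N}"
proof (rule bij_betw_imageI[OF inj_onI equalityI[OF subsetI subsetI]])
  fix l l' assume l: "l \<in> {1..L}" and l': "l' \<in> {1..L}" and eq: "head G l = head G l'"
  show "l = l'"
    using root_path_head[OF l] unfolding eq root_path_head[OF l'] by simp
next
  fix i assume "i \<in> head G ` {1..L}"
  then obtain l where l: "l \<in> {1..L}" "i = head G l" by blast
  have "i \<noteq> 0" using away[OF l(1)] l(2) by (cases "head G l = 0") auto
  then show "i \<in> {1..N}" using ends_in_buses(2)[OF l(1)] l(2) by simp
next
  fix i assume i: "i \<in> {1..N}"
  then have p: "U.apath 0 (root_path G i) i" using apath_root_path by simp
  show "i \<in> head G ` {1..L}"
  proof (cases "root_path G i" rule: rev_cases)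
    case Nil
    then show ?thesis using p i by (simp add: U.apath_Nil_iff)
  next
    case (snoc q a)
    obtain l fwd where a: "a = (l, fwd)" by (cases a)
    have q: "U.apath 0 q (tail (undirected G) a)"
      using p snoc by (auto simp: U.apath_append_iff U.apath_Cons_iff)
    have l: "l \<in> {1..L}" and i_head: "i = head (undirected G) a"
      using p snoc a by (auto simp: U.apath_append_iff U.apath_Cons_iff U.apath_Nil_iff arcs)
    have fwd
    proof (rule ccontr)
      assume "\<not> fwd"
      then have "root_path G (head G l) = q" "i = tail G l"
        using root_path_eqI[OF q] i_head by (auto simp: a)
      then show False using away[OF l] snoc by simp
    qed
    then show ?thesis using l i_head by (auto simp: a)
  qed
qed

lemma lines_eq_buses: "L = N"
  using bij_betw_same_card[OF bij_betw_head] by simp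

end


section \<open>Least-squares problems\<close>

text \<open>
  The normal equations for the columns \<open>a i\<close>, solved by one Gram-Schmidt step per column. The
  residual \<open>f\<close> of \<open>b\<close> and the residual \<open>e\<close> of the new column are orthogonal to the previous
  columns; subtracting from \<open>f\<close> its projection onto \<open>e\<close> makes it orthogonal to the new column as
  well. If the new column depends on the previous ones, \<open>e\<close> vanishes and nothing has to be
  subtracted.
\<close>

lemma orthogonal_residual_exists:
  fixes a :: "'i \<Rightarrow> 'r \<Rightarrow> real"
  assumes "finite I" and R: "finite R"
  shows "\<exists>x. \<forall>j\<in>I. (\<Sum>r\<in>R. a j r * (b r - (\<Sum>i\<in>I. x i * a i r))) = 0"
  using assms(1)
proof (induction I arbitrary: b rule: finite_induct)
  case empty
  then show ?case by simp
next
  case (insert n I)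
  obtain x where x: "\<And>j. j \<in> I \<Longrightarrow> (\<Sum>r\<in>R. a j r * (b r - (\<Sum>i\<in>I. x i * a i r))) = 0"
    using insert.IH[of b] by blast
  obtain y where y: "\<And>j. j \<in> I \<Longrightarrow> (\<Sum>r\<in>R. a j r * (a n r - (\<Sum>i\<in>I. y i * a i r))) = 0"
    using insert.IH[of "a n"] by blast
  define f where "f r = b r - (\<Sum>i\<in>I. x i * a i r)" for r
  define e where "e r = a n r - (\<Sum>i\<in>I. y i * a i r)" for r
  define s where "s = (\<Sum>r\<in>R. e r * e r)"
  (* t * e is the projection of f onto e. *)
  define t where "t = (\<Sum>r\<in>R. e r * f r) / s"
  define X where "X i = (if i = n then t else x i - t * y i)" for i
  have res: "b r - (\<Sum>i\<in>insert n I. X i * a i r) = f r - t * e r" for r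
  proof -
    have "(\<Sum>i\<in>I. X i * a i r) = (\<Sum>i\<in>I. x i * a i r - t * (y i * a i r))"
      using insert.hyps by (intro sum.cong) (auto simp: X_def algebra_simps)
    then show ?thesis
      using insert.hyps
      by (simp add: f_def e_def sum_subtractf sum_distrib_left X_def algebra_simps)
  qed
  have orth: "(\<Sum>r\<in>R. a j r * (f r - t * e r)) = 0" if "j \<in> I" for j
  proof -
    have "(\<Sum>r\<in>R. a j r * (f r - t * e r)) = (\<Sum>r\<in>R. a j r * f r) - t * (\<Sum>r\<in>R. a j r * e r)"
      by (simp add: sum_subtractf sum_distrib_left algebra_simps)
    then show ?thesis using x[OF that] y[OF that] by (simp add: f_def e_def)
  qed
  have "(\<Sum>r\<in>R. e r * (f r - t * e r)) = (\<Sum>r\<in>R. e r * f r) - t * s"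
    by (simp add: s_def sum_subtractf sum_distrib_left algebra_simps)
  (* If s = 0, then t = 0 by division by zero, but e vanishes on R and any t would do. *)
  also have "\<dots> = 0"
  proof (cases "s = 0")
    case True
    then have "\<forall>r\<in>R. e r = 0"
      using R by (simp add: s_def sum_nonneg_eq_0_iff)
    then show ?thesis using True by simp
  qed (simp add: t_def)
  finally have e_orth: "(\<Sum>r\<in>R. e r * (f r - t * e r)) = 0" .
  define h where "h r = f r - t * e r" for r
  have "a n r * h r = e r * h r + (\<Sum>i\<in>I. y i * (a i r * h r))" for r
    by (simp add: e_def left_diff_distrib sum_distrib_right mult.assoc)
  then have "(\<Sum>r\<in>R. a n r * h r)
      = (\<Sum>r\<in>R. e r * h r) + (\<Sum>r\<in>R. \<Sum>i\<in>I. y i * (a i r * h r))"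
    by (simp add: sum.distrib)
  also have "(\<Sum>r\<in>R. \<Sum>i\<in>I. y i * (a i r * h r)) = (\<Sum>i\<in>I. y i * (\<Sum>r\<in>R. a i r * h r))"
    by (subst sum.swap) (simp add: sum_distrib_left)
  also have "\<dots> = 0" using orth by (simp add: h_def)
  finally have "(\<Sum>r\<in>R. a n r * (f r - t * e r)) = 0" using e_orth by (simp add: h_def)
  with orth show ?case
    by (intro exI[of _ X]) (simp add: res)
qed

lemma normal_equations_solvable:
  fixes A :: "real mat"
  assumes A: "A \<in> carrier_mat n c" and b: "b \<in> carrier_vec n"
  obtains x where "x \<in> carrier_vec c" and "transpose_mat A *\<^sub>v (A *\<^sub>v x - b) = 0\<^sub>v c"
proof -
  obtain x where x: "\<And>j. j < c \<Longrightarrow>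
      (\<Sum>r<n. A $$ (r, j) * (b $ r - (\<Sum>i<c. x i * A $$ (r, i)))) = 0"
    using orthogonal_residual_exists[of "{..<c}" "{..<n}" "\<lambda>j r. A $$ (r, j)" "\<lambda>r. b $ r"]
    by auto
  have "transpose_mat A *\<^sub>v (A *\<^sub>v vec c x - b) = 0\<^sub>v c"
  proof (intro eq_vecI)
    fix j assume "j < dim_vec (0\<^sub>v c :: real vec)"
    then have j: "j < c" by simp
    have "(transpose_mat A *\<^sub>v (A *\<^sub>v vec c x - b)) $ j
        = (\<Sum>r<n. A $$ (r, j) * ((\<Sum>i<c. x i * A $$ (r, i)) - b $ r))"
      using A b j
      by (auto simp: scalar_prod_def atLeast0LessThan mult.commute intro!: sum.cong)
    also have "\<dots> = - (\<Sum>r<n. A $$ (r, j) * (b $ r - (\<Sum>i<c. x i * A $$ (r, i))))"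
      by (simp add: sum_negf[symmetric] algebra_simps)
    finally show "(transpose_mat A *\<^sub>v (A *\<^sub>v vec c x - b)) $ j = 0\<^sub>v c $ j"
      using x[OF j] j by simp
  qed (use A in simp)
  then show thesis using that[of "vec c x"] by simp
qed

lemma euclidean_norm_sq: "(euclidean_norm u)\<^sup>2 = u \<bullet> u"
  by (simp add: euclidean_norm_def scalar_prod_def sum_nonneg)

text \<open>
  Pythagoras: the residual of a solution \<open>x\<close> of the normal equations is orthogonal to the range
  of \<open>A\<close>, so the squared residual of \<open>y\<close> exceeds that of \<open>x\<close> by the squared norm of
  \<open>A (y - x)\<close>.
\<close>

lemma least_squares_minimizer_iff:
  assumes A: "A \<in> carrier_mat n c" and b: "b \<in> carrier_vec n" and x: "x \<in> carrier_vec c"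
    and normal: "transpose_mat A *\<^sub>v (A *\<^sub>v x - b) = 0\<^sub>v c"
  shows "least_squares_minimizer c A b y \<longleftrightarrow> y \<in> carrier_vec c \<and> A *\<^sub>v (y - x) = 0\<^sub>v n"
proof -
  define F where "F y = (euclidean_norm (A *\<^sub>v y - b))\<^sup>2" for y
  have pythagoras: "F y = F x + (A *\<^sub>v (y - x)) \<bullet> (A *\<^sub>v (y - x))" if y: "y \<in> carrier_vec c" for y
  proof -
    define e where "e = A *\<^sub>v x - b"
    define g where "g = A *\<^sub>v (y - x)"
    have carr: "e \<in> carrier_vec n" "g \<in> carrier_vec n"
      using A b x y by (auto simp: e_def g_def)
    have eg: "A *\<^sub>v y - b = e + g"
      using A b x y by (intro eq_vecI) (auto simp: e_def g_def mult_minus_distrib_mat_vec)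
    have "e \<bullet> g = (transpose_mat A *\<^sub>v e) \<bullet> (y - x)"
      unfolding g_def using A carr x y by (metis minus_carrier_vec transpose_vec_mult_scalar)
    then have orth: "e \<bullet> g = 0" using normal x y by (simp add: e_def)
    moreover have "g \<bullet> e = 0" using orth comm_scalar_prod[OF carr] by simp
    ultimately have "(e + g) \<bullet> (e + g) = e \<bullet> e + g \<bullet> g"
      using carr by (simp add: add_scalar_prod_distrib[of _ n] scalar_prod_add_distrib[of _ n])
    then show ?thesis unfolding F_def euclidean_norm_sq eg by (simp add: e_def g_def)
  qed
  have nonneg: "g \<bullet> g \<ge> 0" for g :: "real vec"
    by (simp add: scalar_prod_def sum_nonneg)
  have zero: "(A *\<^sub>v (y - x)) \<bullet> (A *\<^sub>v (y - x)) = 0 \<longleftrightarrow> A *\<^sub>v (y - x) = 0\<^sub>v n" for y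
  proof 
    assume *: "(A *\<^sub>v (y - x)) \<bullet> (A *\<^sub>v (y - x)) = 0"
    have "\<forall>i<n. (A *\<^sub>v (y - x)) $ i = 0"
      using * A by (auto simp: scalar_prod_def[of "A *\<^sub>v (y - x)"] sum_nonneg_eq_0_iff
            simp del: index_mult_mat_vec)
    then show "A *\<^sub>v (y - x) = 0\<^sub>v n" using A by (intro eq_vecI) auto
  qed simp
  show ?thesis
    unfolding least_squares_minimizer_def is_arg_min_def F_def[symmetric]
  proof safe
    assume y: "y \<in> carrier_vec c" and "\<nexists>z. z \<in> carrier_vec c \<and> F z < F y"
    then have "F y \<le> F x" using x by force
    then show "A *\<^sub>v (y - x) = 0\<^sub>v n"
      using pythagoras[OF y] nonneg[of "A *\<^sub>v (y - x)"] zero by force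
  next
    fix z assume y: "y \<in> carrier_vec c" "A *\<^sub>v (y - x) = 0\<^sub>v n" and z: "z \<in> carrier_vec c" "F z < F y"
    then show False
      using pythagoras[OF y(1)] pythagoras[OF z(1)] nonneg[of "A *\<^sub>v (z - x)"] by simp
  qed
qed

text \<open>
  The minimizers form a nonempty translate of the kernel of \<open>A\<close>, so two of them differ by an
  arbitrary kernel vector. Nonemptiness matters: without a minimizer every coordinate would be
  vacuously unique.
\<close>

lemma least_squares_coordinate_unique_iff:
  assumes A: "A \<in> carrier_mat n c" and b: "b \<in> carrier_vec n" and j: "j < c"
  shows "(\<forall>x y. least_squares_minimizer c A b x \<longrightarrow> least_squares_minimizer c A b y \<longrightarrow> x $ j = y $ j)
    \<longleftrightarrow> (\<forall>u \<in> carrier_vec c. A *\<^sub>v u = 0\<^sub>v n \<longrightarrow> u $ j = 0)"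
    (is "?unique \<longleftrightarrow> ?kernel")
proof -
  obtain x where x: "x \<in> carrier_vec c" "transpose_mat A *\<^sub>v (A *\<^sub>v x - b) = 0\<^sub>v c"
    using normal_equations_solvable[OF A b] .
  note min_iff = least_squares_minimizer_iff[OF A b x]
  show ?thesis
  proof (intro iffI ballI allI impI)
    fix u assume unique: ?unique and u: "u \<in> carrier_vec c" "A *\<^sub>v u = 0\<^sub>v n"
    have "x + u - x = u" "x - x = 0\<^sub>v c"
      using u x(1) by (auto intro!: eq_vecI)
    then have "least_squares_minimizer c A b (x + u)" "least_squares_minimizer c A b x"
      using u x(1) A by (auto simp: min_iff)
    then have "(x + u) $ j = x $ j"
      using unique by blast
    then show "u $ j = 0" using u(1) x(1) j by simp
  next
    fix y z assume kernel: ?kernel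
      and "least_squares_minimizer c A b y" "least_squares_minimizer c A b z"
    then have "(y - x) $ j = 0" "(z - x) $ j = 0" and "y \<in> carrier_vec c" "z \<in> carrier_vec c"
      using x(1) by (auto simp: min_iff)
    then show "y $ j = z $ j" using x(1) j by simp
  qed
qed


section \<open>The inverse of the reduced incidence matrix\<close>

lemma mat_inverse_eqI:
  fixes A :: "'a :: field mat"
  assumes A: "A \<in> carrier_mat n n" and B: "B \<in> carrier_mat n n" and BA: "B * A = 1\<^sub>m n"
  shows "mat_inverse A = Some B"
proof -
  have AB: "A * B = 1\<^sub>m n" using mat_mult_left_right_inverse[OF B A BA] .
  then have "A \<in> Units (ring_mat TYPE('a) n undefined)"
    using A B BA by (auto simp: Units_def ring_mat_def)
  then obtain C where C: "mat_inverse A = Some C"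
    using mat_inverse(1)[OF A, where b = undefined] by (cases "mat_inverse A") blast+
  then have "C * A = 1\<^sub>m n" "C \<in> carrier_mat n n"
    using mat_inverse(2)[OF A C] by auto
  then have "C = B"
    using A B AB assoc_mult_mat[of C n n A n B n] by auto
  with C show ?thesis by simp
qed

context radial
begin

definition path_indicator :: "nat \<Rightarrow> nat \<Rightarrow> real" where
  "path_indicator l i = (if l \<in> path_lines G i then 1 else 0)"

lemma path_indicator_root [simp]: "path_indicator l 0 = 0"
  by (simp add: path_indicator_def path_lines_def)

text \<open>
  The root paths of the two ends of a line differ in exactly that line, so the difference of the
  indicators along a line is a Kronecker delta. This is the reason why \<open>path_mat\<close>, defined
  below, inverts the reduced incidence matrix.
\<close>

lemma path_indicator_head:
  assumes "l' \<in> {1..L}"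
  shows "path_indicator l (head G l') - path_indicator l (tail G l') = (if l = l' then 1 else 0)"
  using path_lines_head[OF assms] line_not_on_root_path_tail[OF assms]
  by (auto simp: path_indicator_def)

text \<open>
  The sign is due to the convention that a line contributes \<open>-1\<close> at its receiving end.
\<close>

definition path_mat :: "real mat" where
  "path_mat = mat N N (\<lambda>(j, i). - path_indicator (Suc j) (Suc i))"

lemma path_mat_carrier [simp]: "path_mat \<in> carrier_mat N N"
  and dim_path_mat [simp]: "dim_row path_mat = N" "dim_col path_mat = N"
  by (simp_all add: path_mat_def)

lemma reduced_incidence_mat_carrier [simp]: "reduced_incidence_mat N L G \<in> carrier_mat N N"
  by (simp add: reduced_incidence_mat_def lines_eq_buses)

lemma path_mat_mult_incidence: "path_mat * reduced_incidence_mat N L G = 1\<^sub>m N"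
proof (rule eq_matI)
  fix j j' assume "j < dim_row (1\<^sub>m N :: real mat)" "j' < dim_col (1\<^sub>m N :: real mat)"
  then have j: "j < N" and j': "j' < N" by auto
  let ?l = "Suc j" and ?l' = "Suc j'"
  have l': "?l' \<in> {1..L}" using j' by (simp add: lines_eq_buses)
  have ends: "tail G ?l' \<le> N" "head G ?l' \<le> N" "tail G ?l' \<noteq> head G ?l'"
    using ends_in_buses[OF l'] away[OF l'] by auto
  let ?f = "\<lambda>i. - path_indicator ?l i *
      ((if tail G ?l' = i then 1 else 0) - (if head G ?l' = i then 1 else 0))"
  have "(path_mat * reduced_incidence_mat N L G) $$ (j, j') = (\<Sum>i<N. ?f (Suc i))"
    using j j' ends(3)
    by (auto simp: path_mat_def reduced_incidence_mat_def incidence_mat_def scalar_prod_def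
        lines_eq_buses atLeast0LessThan intro!: sum.cong)
  (* The deleted row of the root can be added back: no line lies on the empty root path. *)
  also have "\<dots> = (\<Sum>i\<le>N. ?f i)"
    by (simp add: sum.atMost_shift)
  also have "\<dots> = path_indicator ?l (head G ?l') - path_indicator ?l (tail G ?l')"
    using ends by (simp add: right_diff_distrib sum_subtractf if_distrib[of "times _"] cong: if_cong)
  also have "\<dots> = 1\<^sub>m N $$ (j, j')"
    using j j' path_indicator_head[OF l'] by simp
  finally show "(path_mat * reduced_incidence_mat N L G) $$ (j, j') = 1\<^sub>m N $$ (j, j')" .
qed (auto simp: path_mat_def reduced_incidence_mat_def lines_eq_buses)

lemma mat_inverse_reduced_incidence: "mat_inverse (reduced_incidence_mat N L G) = Some path_mat"
  by (rule mat_inverse_eqI) (auto intro: path_mat_mult_incidence)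

text \<open>
  The rows of an invertible matrix are linearly independent.
\<close>

lemma transpose_path_mat_mult_eq_0_iff:
  assumes w: "w \<in> carrier_vec N"
  shows "transpose_mat path_mat *\<^sub>v w = 0\<^sub>v N \<longleftrightarrow> w = 0\<^sub>v N"
proof
  let ?M = "reduced_incidence_mat N L G"
  assume 0: "transpose_mat path_mat *\<^sub>v w = 0\<^sub>v N"
  have "transpose_mat ?M * transpose_mat path_mat = 1\<^sub>m N"
    using path_mat_mult_incidence transpose_mult[of path_mat N N ?M N] by simp
  then have "w = (transpose_mat ?M * transpose_mat path_mat) *\<^sub>v w"
    using w by simp
  also have "\<dots> = transpose_mat ?M *\<^sub>v (transpose_mat path_mat *\<^sub>v w)"
    using w by (intro assoc_mult_mat_vec[of _ N N _ N])
      (simp_all only: transpose_carrier_mat reduced_incidence_mat_carrier path_mat_carrier)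
  also have "\<dots> = 0\<^sub>v N"
    unfolding 0 by (intro eq_vecI) (auto simp: scalar_prod_def reduced_incidence_mat_def lines_eq_buses)
  finally show "w = 0\<^sub>v N" .
qed (auto intro!: eq_vecI simp: path_mat_def)


section \<open>The kernel of the regression matrix\<close>

definition downstream_load :: "(nat \<Rightarrow> real) \<Rightarrow> (nat \<Rightarrow> real) \<Rightarrow> (nat \<Rightarrow> real) \<Rightarrow> nat \<Rightarrow> real" where
  "downstream_load z p q l = (\<Sum>i \<in> downstream N G l. z l * p i + q i)"

text \<open>
  Pairing with a row of the inverse sums over the downstream buses, which is how the downstream
  sums of the injections arise.
\<close>

lemma path_mat_row_rho:
  assumes l: "l \<in> {1..L}"
  shows "row path_mat (l - 1) \<bullet> rho N \<gamma> k z p q l k'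
      = - discount \<gamma> k k' * downstream_load z (p k') (q k') l"
proof -
  let ?f = "\<lambda>i. path_indicator l i * (z l * p k' i + q k' i)"
  have "row path_mat (l - 1) \<bullet> rho N \<gamma> k z p q l k' = (\<Sum>i<N. - discount \<gamma> k k' * ?f (Suc i))"
    using l by (auto simp: scalar_prod_def path_mat_def rho_def bus_vec_def lines_eq_buses
        atLeast0LessThan intro!: sum.cong)
  also have "\<dots> = - discount \<gamma> k k' * (\<Sum>i\<in>{1..N}. ?f i)"
    by (simp add: sum_negf sum_distrib_left[symmetric] sum.atLeast1_atMost_eq)
  also have "(\<Sum>i\<in>{1..N}. ?f i) = downstream_load z (p k') (q k') l"
    unfolding downstream_load_def downstream_def
    by (auto simp: path_indicator_def intro!: sum.mono_neutral_cong_right split: if_splits)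
  finally show ?thesis .
qed

text \<open>
  The matrix of line \<open>l\<close> is the rank-one matrix built from row \<open>l\<close> of the inverse.
\<close>

lemma Xi_mult_vec:
  assumes l: "l \<in> {1..L}" and w: "w \<in> carrier_vec N"
  shows "Xi N L G l *\<^sub>v w = (2 * (row path_mat (l - 1) \<bullet> w)) \<cdot>\<^sub>v row path_mat (l - 1)"
proof -
  let ?B = path_mat and ?e = "unit_vec N (l - 1) :: real vec"
  let ?E = "mat_of_cols N [?e]"
  have j: "l - 1 < N" using l by (auto simp: lines_eq_buses)
  have E: "?E \<in> carrier_mat N 1" using mat_of_cols_carrier(1)[of N "[?e]"] by simp
  have B: "?B \<in> carrier_mat N N" by simp
  let ?t = "row ?B (l - 1) \<bullet> w"
  have BE: "transpose_mat ?B * ?E \<in> carrier_mat N 1"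
    and BEE: "transpose_mat ?B * ?E * transpose_mat ?E \<in> carrier_mat N N"
    and BEEB: "transpose_mat ?B * ?E * transpose_mat ?E * ?B \<in> carrier_mat N N"
    using B E by auto
  have Bw: "?B *\<^sub>v w \<in> carrier_vec N" using B w by (rule mult_mat_vec_carrier)
  have EBw: "transpose_mat ?E *\<^sub>v (?B *\<^sub>v w) = vec 1 (\<lambda>_. ?t)"
    using Bw E j by (intro eq_vecI) auto
  have EEBw: "?E *\<^sub>v vec 1 (\<lambda>_. ?t) = ?t \<cdot>\<^sub>v ?e"
    using E j by (intro eq_vecI) (auto simp: scalar_prod_def mat_of_cols_def)
  have BEEBw: "transpose_mat ?B *\<^sub>v (?t \<cdot>\<^sub>v ?e) = ?t \<cdot>\<^sub>v row ?B (l - 1)"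
    using j by (intro eq_vecI) auto
  have product: "(transpose_mat ?B * ?E * transpose_mat ?E * ?B) *\<^sub>v w = ?t \<cdot>\<^sub>v row ?B (l - 1)"
    using B E assoc_mult_mat_vec[OF BEE B w] assoc_mult_mat_vec[OF BE _ Bw, of "transpose_mat ?E"]
      assoc_mult_mat_vec[of "transpose_mat ?B" N N ?E 1 "vec 1 (\<lambda>_. ?t)"]
    by (simp only: EBw EEBw BEEBw transpose_carrier_mat vec_carrier simp_thms)
  have "Xi N L G l = 2 \<cdot>\<^sub>m (transpose_mat ?B * ?E * transpose_mat ?E * ?B)"
    unfolding Xi_def mat_inverse_reduced_incidence Let_def option.sel by (simp add: lines_eq_buses)
  moreover have "(2 \<cdot>\<^sub>m C) *\<^sub>v w = 2 \<cdot>\<^sub>v (C *\<^sub>v w)" if "C \<in> carrier_mat N N" for C :: "real mat"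
    using that w by (intro eq_vecI) auto
  ultimately show ?thesis using product BEEB by (simp add: smult_smult_assoc)
qed

lemma dim_Psi [simp]:
  "dim_row (Psi N L G \<gamma> k m z p q) = (m + 1) * N"
  "dim_col (Psi N L G \<gamma> k m z p q) = N"
  unfolding Psi_def mat_of_cols_carrier by (simp_all only: length_map length_upt lines_eq_buses diff_add_inverse2)

lemma Psi_index:
  fixes k :: int and m :: nat
  assumes r: "r < (m + 1) * N" and j: "j < N"
  defines "k' \<equiv> k - int m + int (r div N)"
  shows "Psi N L G \<gamma> k m z p q $$ (r, j)
    = - 2 * discount \<gamma> k k' * downstream_load z (p k') (q k') (Suc j) * path_mat $$ (j, r mod N)"
proof -
  have l: "Suc j \<in> {1..L}" and i: "r mod N < N" using j by (auto simp: lines_eq_buses)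
  have nth: "[1..<L + 1] ! j = Suc j" "j < length [1..<L + 1]"
    using j by (simp_all add: lines_eq_buses del: upt_Suc)
  have "Psi N L G \<gamma> k m z p q $$ (r, j)
      = (Xi N L G (Suc j) *\<^sub>v rho N \<gamma> k z p q (Suc j) k') $ (r mod N)"
    using r nth by (simp add: Psi_def mat_of_cols_index stack_def k'_def del: upt_Suc)
  also have "\<dots> = - 2 * discount \<gamma> k k' * downstream_load z (p k') (q k') (Suc j)
      * path_mat $$ (j, r mod N)"
    using i j path_mat_row_rho[OF l, of \<gamma> k z p q k']
    by (subst Xi_mult_vec[OF l]) (auto simp: rho_def bus_vec_def)
  finally show ?thesis .
qed

text \<open>
  In each time block the unknowns enter only through the invertible matrix \<open>path_mat\<close>, after
  being scaled line by line with the downstream loads.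
\<close>

lemma Psi_mult_vec:
  assumes u: "u \<in> carrier_vec N"
  shows "Psi N L G \<gamma> k m z p q *\<^sub>v u
    = stack N k m (\<lambda>k'. transpose_mat path_mat *\<^sub>v
        vec N (\<lambda>j. - 2 * discount \<gamma> k k' * downstream_load z (p k') (q k') (Suc j) * u $ j))"
    (is "_ = stack N k m (\<lambda>k'. _ *\<^sub>v ?w k')")
proof (rule eq_vecI)
  fix r assume "r < dim_vec (stack N k m (\<lambda>k'. transpose_mat path_mat *\<^sub>v ?w k'))"
  then have r: "r < (m + 1) * N" by (simp add: stack_def)
  then have "N \<noteq> 0" by (cases "N = 0") simp_all
  then have i: "r mod N < N" by simp
  let ?k = "k - int m + int (r div N)"
  have "(Psi N L G \<gamma> k m z p q *\<^sub>v u) $ r = (\<Sum>j<N. Psi N L G \<gamma> k m z p q $$ (r, j) * u $ j)"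
    using r u by (simp add: scalar_prod_def atLeast0LessThan)
  also have "\<dots> = (\<Sum>j<N. path_mat $$ (j, r mod N) * ?w ?k $ j)"
    by (rule sum.cong) (simp_all add: Psi_index[OF r])
  also have "\<dots> = (transpose_mat path_mat *\<^sub>v ?w ?k) $ (r mod N)"
    using i by (simp add: scalar_prod_def atLeast0LessThan)
  finally show "(Psi N L G \<gamma> k m z p q *\<^sub>v u) $ r
      = stack N k m (\<lambda>k'. transpose_mat path_mat *\<^sub>v ?w k') $ r"
    using r by (simp add: stack_def)
qed (simp add: stack_def)

text \<open>
  The entry of \<open>f k'\<close> at \<open>i\<close> sits at position \<open>(k' - (k - m)) N + i\<close> of the stacked vector.
\<close>

lemma stack_eq_0_iff:
  assumes f: "\<And>k'. f k' \<in> carrier_vec N"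
  shows "stack N k m f = 0\<^sub>v ((m + 1) * N) \<longleftrightarrow> (\<forall>k' \<in> {k - int m..k}. f k' = 0\<^sub>v N)"
proof (intro iffI ballI)
  fix k' assume 0: "stack N k m f = 0\<^sub>v ((m + 1) * N)" and k': "k' \<in> {k - int m..k}"
  show "f k' = 0\<^sub>v N"
  proof (rule eq_vecI)
    fix i assume "i < dim_vec (0\<^sub>v N :: real vec)"
    then have i: "i < N" by simp
    define t where "t = nat (k' - (k - int m))"
    have t: "t \<le> m" "k - int m + int t = k'" using k' by (auto simp: t_def)
    have "t * N + i < Suc t * N" using i by simp
    also have "\<dots> \<le> (m + 1) * N" using t(1) by (intro mult_right_mono) auto
    finally have "t * N + i < (m + 1) * N" .
    then have "stack N k m f $ (t * N + i) = f k' $ i"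
      using i t(2) by (simp add: stack_def)
    then show "f k' $ i = 0\<^sub>v N $ i"
      using 0 \<open>t * N + i < (m + 1) * N\<close> i by simp
  qed (use carrier_vecD[OF f] in simp)
next
  assume 0: "\<forall>k' \<in> {k - int m..k}. f k' = 0\<^sub>v N"
  show "stack N k m f = 0\<^sub>v ((m + 1) * N)"
  proof (rule eq_vecI)
    fix r assume "r < dim_vec (0\<^sub>v ((m + 1) * N) :: real vec)"
    then have r: "r < (m + 1) * N" by simp
    then have "N \<noteq> 0" by (cases "N = 0") simp_all
    then have "r mod N < N" by simp
    moreover have "r div N \<le> m"
      using less_mult_imp_div_less[OF r] by simp
    ultimately show "stack N k m f $ r = 0\<^sub>v ((m + 1) * N) $ r"
      using r 0 by (simp add: stack_def)
  qed (simp add: stack_def)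
qed

text \<open>
  Both the discount factor and \<open>path_mat\<close> are invertible and can be cancelled, which decouples
  the lines.
\<close>

lemma Psi_kernel_iff:
  assumes u: "u \<in> carrier_vec N" and \<gamma>: "0 < \<gamma>"
  shows "Psi N L G \<gamma> k m z p q *\<^sub>v u = 0\<^sub>v ((m + 1) * N) \<longleftrightarrow>
    (\<forall>k' \<in> {k - int m..k}. \<forall>j<N. downstream_load z (p k') (q k') (Suc j) = 0 \<or> u $ j = 0)"
proof -
  have discount: "discount \<gamma> k k' \<noteq> 0" for k'
    using \<gamma> by (simp add: discount_def)
  let ?w = "\<lambda>k'. vec N (\<lambda>j. - 2 * discount \<gamma> k k' * downstream_load z (p k') (q k') (Suc j) * u $ j)"
  have "Psi N L G \<gamma> k m z p q *\<^sub>v u = 0\<^sub>v ((m + 1) * N) \<longleftrightarrow>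
      (\<forall>k' \<in> {k - int m..k}. transpose_mat path_mat *\<^sub>v ?w k' = 0\<^sub>v N)"
    unfolding Psi_mult_vec[OF u] by (rule stack_eq_0_iff, rule carrier_vecI) simp
  also have "\<dots> \<longleftrightarrow> (\<forall>k' \<in> {k - int m..k}. ?w k' = 0\<^sub>v N)"
    by (simp add: transpose_path_mat_mult_eq_0_iff)
  also have "\<dots> \<longleftrightarrow>
      (\<forall>k' \<in> {k - int m..k}. \<forall>j<N. downstream_load z (p k') (q k') (Suc j) = 0 \<or> u $ j = 0)"
    using discount by (simp add: vec_eq_iff)
  finally show ?thesis .
qed

lemma identifiable_iff:
  assumes \<gamma>: "0 < \<gamma>" and l: "l \<in> {1..L}"
  shows "identifiable N L G \<gamma> k m z p q v l \<longleftrightarrow>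
    (\<exists>k' \<in> {k - int m..k}. downstream_load z (p k') (q k') l \<noteq> 0)"
proof -
  let ?A = "Psi N L G \<gamma> k m z p q"
  have "?A \<in> carrier_mat ((m + 1) * N) N"
    by (rule carrier_matI) simp_all
  then have A: "?A \<in> carrier_mat ((m + 1) * N) L"
    unfolding lines_eq_buses .
  have b: "psi N \<gamma> k m v \<in> carrier_vec ((m + 1) * N)"
    by (rule carrier_vecI) (simp add: psi_def stack_def)
  have pos: "l - 1 < L" using l by auto
  have "identifiable N L G \<gamma> k m z p q v l \<longleftrightarrow>
      (\<forall>u \<in> carrier_vec N. ?A *\<^sub>v u = 0\<^sub>v ((m + 1) * N) \<longrightarrow> u $ (l - 1) = 0)"
    unfolding identifiable_def
    by (subst least_squares_coordinate_unique_iff[OF A b pos]) (simp only: lines_eq_buses)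
  also have "\<dots> \<longleftrightarrow> (\<forall>u :: real vec \<in> carrier_vec N.
      (\<forall>k' \<in> {k - int m..k}. \<forall>j<N. downstream_load z (p k') (q k') (Suc j) = 0 \<or> u $ j = 0)
        \<longrightarrow> u $ (l - 1) = 0)"
    by (intro ball_cong refl) (simp only: Psi_kernel_iff[OF _ \<gamma>])
  also have "\<dots> \<longleftrightarrow> (\<exists>k' \<in> {k - int m..k}. downstream_load z (p k') (q k') l \<noteq> 0)"
    (is "?kernel \<longleftrightarrow> ?excited")
  proof
    assume kernel: ?kernel
    show ?excited
    proof (rule ccontr)
      (* An unexcited line can be changed freely without changing the predictions. *)
      assume "\<not> ?excited"
      then have "unit_vec N (l - 1) $ (l - 1) = (0 :: real)"
        using l by (intro kernel[rule_format]) (auto simp: unit_vec_def split: if_splits)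
      then show False
        using pos unfolding lines_eq_buses by simp
    qed
  next
    have "l - 1 < N" "Suc (l - 1) = l" using l by (auto simp: lines_eq_buses)
    moreover assume ?excited
    ultimately show ?kernel by metis
  qed
  finally show ?thesis .
qed

end

theorem theorem1:
  fixes N L m l :: nat and G :: "(nat, nat) pre_digraph" and \<gamma> :: real and k :: int
    and z :: "nat \<Rightarrow> real" and p q v :: "int \<Rightarrow> nat \<Rightarrow> real"
  assumes "radial_network N L G"
    and "0 < \<gamma>" and "\<gamma> \<le> 1"
    and "l \<in> {1..L}"
  shows "identifiable N L G \<gamma> k m z p q v l \<longleftrightarrow>
    (\<exists>k' \<in> {k - int m..k}. (\<Sum>i \<in> downstream N G l. z l * p k' i + q k' i) \<noteq> 0)"
proof -
  interpret radial N L G by standard fact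
  show ?thesis
    using identifiable_iff[OF assms(2,4)] by (simp add: downstream_load_def)
qed

end
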